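(* Let $\lambda$ be a nonzero real number. For all integers $n,j$ with $n\ge j\ge0$, $$ {n \brace j}_{\lambda}=\sum_{\alpha=0}^{n}\binom{n}{\alpha}(-1)^{\alpha+j}{\alpha \brace j}_{-\lambda}(j)_{n-\alpha,\lambda}. $$
   Context: For a real parameter $\mu$ the degenerate falling factorials are $(x)_{0,\mu}=1$ and $(x)_{n,\mu}=x(x-\mu)\cdots(x-(n-1)\mu)$ for $n\ge1$; $(x)_n=(x)_{n,1}$ is the usual falling factorial. The degenerate Stirling numbers of the second kind ${n \brace k}_{\mu}$ are defined by $(x)_{n,\mu}=\sum_{k=0}^{n}{n \brace k}_{\mu}(x)_k$, with ${n \brace k}_{\mu}=0$ for $k>n$. *)

theory Defs
  imports Complex_Main
begin

definition degen_ffact :: "real \<Rightarrow> real \<Rightarrow> nat \<Rightarrow> real" where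
  "degen_ffact \<mu> x n = (\<Prod>i<n. x - real i * \<mu>)"

definition is_degen_Stirling_row :: "real \<Rightarrow> nat \<Rightarrow> (nat \<Rightarrow> real) \<Rightarrow> bool" where
  "is_degen_Stirling_row \<mu> n c \<longleftrightarrow>
     (\<forall>x. degen_ffact \<mu> x n = (\<Sum>k\<le>n. c k * degen_ffact 1 x k)) \<and> (\<forall>k>n. c k = 0)"

text \<open>
  The numbers are the coefficients of the expansion in ordinary falling factorials;
  the description is justified by the existence and uniqueness lemma below.
\<close>
definition degen_Stirling2 :: "real \<Rightarrow> nat \<Rightarrow> nat \<Rightarrow> real" where
  "degen_Stirling2 \<mu> n = (THE c. is_degen_Stirling_row \<mu> n c)"

lemma degen_ffact_Suc: "degen_ffact \<mu> x (Suc n) = degen_ffact \<mu> x n * (x - real n * \<mu>)"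
  by (simp add: degen_ffact_def)

lemma degen_ffact_1_eq_0: "m < k \<Longrightarrow> degen_ffact 1 (real m) k = 0"
  by (force simp: degen_ffact_def)

lemma degen_ffact_1_self_neq_0: "degen_ffact 1 (real m) m \<noteq> 0"
  by (simp add: degen_ffact_def)

lemma is_degen_Stirling_row_exists: "\<exists>c. is_degen_Stirling_row \<mu> n c"
proof (induction n)
  case 0
  show ?case
    by (rule exI[of _ "\<lambda>k. if k = 0 then 1 else 0"])
       (simp add: is_degen_Stirling_row_def degen_ffact_def)
next
  case (Suc n)
  then obtain c where c: "\<And>x. degen_ffact \<mu> x n = (\<Sum>k\<le>n. c k * degen_ffact 1 x k)"
    and c0: "\<And>k. k > n \<Longrightarrow> c k = 0"
    by (auto simp: is_degen_Stirling_row_def)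
  define d where "d k = (case k of 0 \<Rightarrow> 0 | Suc l \<Rightarrow> c l) + (real k - real n * \<mu>) * c k" for k
  have "degen_ffact \<mu> x (Suc n) = (\<Sum>k\<le>Suc n. d k * degen_ffact 1 x k)" for x
  proof -
    let ?f = "degen_ffact 1 x"
    have "degen_ffact \<mu> x (Suc n) = (\<Sum>k\<le>n. c k * ?f k * (x - real n * \<mu>))"
      by (simp add: degen_ffact_Suc c sum_distrib_right)
    also have "\<dots> = (\<Sum>k\<le>n. c k * ?f (Suc k)) + (\<Sum>k\<le>n. (real k - real n * \<mu>) * c k * ?f k)"
      unfolding sum.distrib[symmetric]
      by (rule sum.cong) (simp_all add: degen_ffact_Suc algebra_simps)
    also have "(\<Sum>k\<le>n. c k * ?f (Suc k))
        = (\<Sum>k\<le>Suc n. (case k of 0 \<Rightarrow> 0 | Suc l \<Rightarrow> c l) * ?f k)"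
      by (simp add: sum.atMost_Suc_shift del: sum.atMost_Suc)
    also have "(\<Sum>k\<le>n. (real k - real n * \<mu>) * c k * ?f k)
        = (\<Sum>k\<le>Suc n. (real k - real n * \<mu>) * c k * ?f k)"
      by (simp add: c0)
    finally show ?thesis
      unfolding d_def sum.distrib[symmetric] by (simp add: distrib_right del: sum.atMost_Suc)
  qed
  moreover have "d k = 0" if "k > Suc n" for k
    using that by (cases k) (auto simp: d_def c0)
  ultimately show ?case
    by (auto simp: is_degen_Stirling_row_def simp del: sum.atMost_Suc)
qed

lemma is_degen_Stirling_row_unique:
  assumes c: "is_degen_Stirling_row \<mu> n c" and d: "is_degen_Stirling_row \<mu> n d"
  shows "c = d"
proof
  fix m
  show "c m = d m"
  proof (cases "m \<le> n")
    case False
    then show ?thesis using c d by (auto simp: is_degen_Stirling_row_def)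
  next
    case True
    then show ?thesis
    proof (induction m rule: less_induct)
      case (less m)
      let ?f = "degen_ffact 1 (real m)"
      have *: "(\<Sum>k\<le>n. (c k - d k) * ?f k) = 0"
        using c d by (simp add: is_degen_Stirling_row_def left_diff_distrib sum_subtractf)
      have "(\<Sum>k\<le>n. (c k - d k) * ?f k) = (\<Sum>k\<in>{m}. (c k - d k) * ?f k)"
      proof (rule sum.mono_neutral_right)
        show "\<forall>k\<in>{..n} - {m}. (c k - d k) * ?f k = 0"
        proof
          fix k assume "k \<in> {..n} - {m}"
          then have "k < m \<or> m < k" "k \<le> n" by auto
          then show "(c k - d k) * ?f k = 0"
            using less.IH[of k] degen_ffact_1_eq_0[of m k] by auto
        qed
      qed (use less.prems in auto)
      with * show ?case using degen_ffact_1_self_neq_0[of m] by simp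
    qed
  qed
qed

lemma is_degen_Stirling_row_degen_Stirling2:
  "is_degen_Stirling_row \<mu> n (degen_Stirling2 \<mu> n)"
  unfolding degen_Stirling2_def
  using is_degen_Stirling_row_exists is_degen_Stirling_row_unique by (metis theI')

end

theory Submission
  imports Defs "HOL-Computational_Algebra.Formal_Power_Series"
begin

text \<open>
  Expanding in falling factorials and taking the \<open>j\<close>-th finite difference at \<open>0\<close> gives the explicit
  formula \<open>(-1)^j j! S\<^sub>\<mu>(n,j) = \<Sum>i\<le>j. (-1)^i (j choose i) (i)\<^sub>n\<^sub>,\<^sub>\<mu>\<close>. Insert it for \<open>\<mu> = -\<lambda>\<close> on the right-hand side:
  since \<open>(-1)^\<alpha> (i)\<^sub>\<alpha>\<^sub>,\<^sub>-\<^sub>\<lambda> = (-i)\<^sub>\<alpha>\<^sub>,\<^sub>\<lambda>\<close>, the sum over \<open>\<alpha>\<close> is a Vandermonde convolution with value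
  \<open>(j-i)\<^sub>n\<^sub>,\<^sub>\<lambda>\<close>, and the reflection \<open>i \<mapsto> j - i\<close> yields the explicit formula for \<open>\<mu> = \<lambda>\<close>.
\<close>

lemma degen_ffact_0 [simp]: "degen_ffact \<mu> x 0 = 1"
  by (simp add: degen_ffact_def)

text \<open>Peels off the first factor \<open>x\<close> rather than the last; for
  \<open>\<mu> = 1\<close> this is the factor that binomial absorption consumes.\<close>

lemma degen_ffact_Suc_left: "degen_ffact \<mu> x (Suc n) = x * degen_ffact \<mu> (x - \<mu>) n"
  unfolding degen_ffact_def prod.lessThan_Suc_shift by (simp add: algebra_simps)

lemma degen_ffact_uminus: "(-1) ^ n * degen_ffact (- \<mu>) x n = degen_ffact \<mu> (- x) n"
  by (induction n) (simp_all add: degen_ffact_Suc algebra_simps)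

text \<open>Extracting \<open>\<mu>\<close> from every factor leaves an ordinary falling factorial
  of \<open>x / \<mu>\<close>, so binomial identities carry over.\<close>

lemma degen_ffact_eq_gbinomial:
  assumes "\<mu> \<noteq> 0"
  shows "degen_ffact \<mu> x n = \<mu> ^ n * fact n * (x / \<mu> gchoose n)"
proof -
  have "degen_ffact \<mu> x n = (\<Prod>i<n. \<mu> * (x / \<mu> - real i))"
    unfolding degen_ffact_def using assms by (intro prod.cong) (simp_all add: field_simps)
  then show ?thesis
    by (simp add: prod.distrib gbinomial_prod_rev lessThan_atLeast0)
qed

lemma degen_ffact_Vandermonde:
  assumes "\<mu> \<noteq> 0"
  shows "(\<Sum>k=0..n. real (n choose k) * degen_ffact \<mu> x k * degen_ffact \<mu> y (n - k))
    = degen_ffact \<mu> (x + y) n"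
proof -
  have "real (n choose k) * degen_ffact \<mu> x k * degen_ffact \<mu> y (n - k)
      = \<mu> ^ n * fact n * ((x / \<mu> gchoose k) * (y / \<mu> gchoose (n - k)))" if "k \<le> n" for k
  proof -
    have "\<mu> ^ k * \<mu> ^ (n - k) = \<mu> ^ n"
      using that by (simp flip: power_add)
    moreover have "real (n choose k) * fact k * fact (n - k) = fact n"
      using binomial_fact[OF that, where 'a = real] by (simp add: field_simps)
    ultimately show ?thesis
      unfolding degen_ffact_eq_gbinomial[OF assms] by (smt (verit) mult.assoc mult.commute)
  qed
  then have "(\<Sum>k=0..n. real (n choose k) * degen_ffact \<mu> x k * degen_ffact \<mu> y (n - k))
      = \<mu> ^ n * fact n * (\<Sum>k=0..n. (x / \<mu> gchoose k) * (y / \<mu> gchoose (n - k)))"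
    by (simp add: sum_distrib_left)
  then show ?thesis
    unfolding gbinomial_Vandermonde degen_ffact_eq_gbinomial[OF assms] by (simp add: add_divide_distrib)
qed

text \<open>Up to the sign \<open>(-1) ^ j\<close> this is the finite difference of order
  \<open>j\<close> at 0, which picks out \<open>k = j\<close>. Absorption lowers \<open>j\<close>
  and \<open>k\<close> together, hence the induction with \<open>j\<close> arbitrary.\<close>

lemma alternating_sum_choose_ffact:
  "(\<Sum>i\<le>j. (-1) ^ i * real (j choose i) * degen_ffact 1 (real i) k)
    = (if k = j then (-1) ^ j * fact j else 0)"
proof (induction k arbitrary: j)
  case 0
  show ?case
    using choose_alternating_sum[of j, where 'a = real] by (cases "j = 0") auto
next
  case (Suc k)
  show ?case
  proof (cases j)
    case 0
    then show ?thesis by (simp add: degen_ffact_Suc_left)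
  next
    case (Suc m)
    have absorb: "real (Suc m choose Suc i) * real (Suc i) = real (Suc m) * real (m choose i)" for i
      using Suc_times_binomial_eq[of m i] by (metis of_nat_mult)
    \<comment> \<open>The term at index 0 vanishes, since its falling factorial contains the factor
      0.\<close>
    have "(\<Sum>i\<le>Suc m. (-1) ^ i * real (Suc m choose i) * degen_ffact 1 (real i) (Suc k))
        = (\<Sum>i\<le>m. (-1) ^ Suc i * (real (Suc m choose Suc i) * real (Suc i)) * degen_ffact 1 (real i) k)"
      unfolding sum.atMost_Suc_shift by (simp add: degen_ffact_Suc_left mult.assoc)
    also have "\<dots> = - real (Suc m) * (\<Sum>i\<le>m. (-1) ^ i * real (m choose i) * degen_ffact 1 (real i) k)"
      unfolding absorb sum_distrib_left by (intro sum.cong) (simp_all add: algebra_simps)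
    also have "\<dots> = (if Suc k = Suc m then (-1) ^ Suc m * fact (Suc m) else 0)"
      unfolding Suc.IH by (simp add: algebra_simps)
    finally show ?thesis
      by (simp only: Suc)
  qed
qed

lemma degen_Stirling2_explicit:
  "(-1) ^ j * fact j * degen_Stirling2 \<mu> n j
    = (\<Sum>i\<le>j. (-1) ^ i * real (j choose i) * degen_ffact \<mu> (real i) n)"
proof -
  let ?S = "degen_Stirling2 \<mu> n"
  have row: "degen_ffact \<mu> x n = (\<Sum>k\<le>n. ?S k * degen_ffact 1 x k)"
    and zero: "n < k \<Longrightarrow> ?S k = 0" for x k
    using is_degen_Stirling_row_degen_Stirling2[of \<mu> n] by (auto simp: is_degen_Stirling_row_def)
  have "(\<Sum>i\<le>j. (-1) ^ i * real (j choose i) * degen_ffact \<mu> (real i) n)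
      = (\<Sum>k\<le>n. ?S k * (\<Sum>i\<le>j. (-1) ^ i * real (j choose i) * degen_ffact 1 (real i) k))"
    unfolding row sum_distrib_left by (subst sum.swap) (simp add: mult_ac)
  also have "\<dots> = (\<Sum>k\<le>n. if k = j then ?S k * ((-1) ^ j * fact j) else 0)"
    unfolding alternating_sum_choose_ffact by (intro sum.cong) auto
  \<comment> \<open>For \<open>j > n\<close> no index matches, in agreement with
    \<open>?S j = 0\<close>.\<close>
  also have "\<dots> = (-1) ^ j * fact j * ?S j"
    using zero[of j] by (simp add: not_le)
  finally show ?thesis ..
qed

theorem theorem2p6:
  fixes l :: real and n j :: nat
  assumes "l \<noteq> 0" and "j \<le> n"
  shows "degen_Stirling2 l n j =
    (\<Sum>\<alpha>=0..n. real (n choose \<alpha>) * (-1) ^ (\<alpha> + j) * degen_Stirling2 (- l) \<alpha> j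
        * degen_ffact l (real j) (n - \<alpha>))"
    (is "_ = ?R")
proof -
  let ?b = "\<lambda>i. (-1) ^ i * real (j choose i)"
  \<comment> \<open>The sign is split: \<open>(-1) ^ j\<close> joins \<open>fact j\<close> to match
    the explicit formula, while \<open>(-1) ^ \<alpha>\<close> is kept to turn the parameter
    \<open>- l\<close> into \<open>l\<close>.\<close>
  have "fact j * ?R = (\<Sum>\<alpha>=0..n. real (n choose \<alpha>) * (-1) ^ \<alpha>
      * ((-1) ^ j * fact j * degen_Stirling2 (- l) \<alpha> j) * degen_ffact l (real j) (n - \<alpha>))"
    unfolding sum_distrib_left by (intro sum.cong) (simp_all add: power_add mult_ac)
  also have "\<dots> = (\<Sum>\<alpha>=0..n. \<Sum>i\<le>j. ?b i * (real (n choose \<alpha>)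
      * ((-1) ^ \<alpha> * degen_ffact (- l) (real i) \<alpha>) * degen_ffact l (real j) (n - \<alpha>)))"
    unfolding degen_Stirling2_explicit sum_distrib_left sum_distrib_right
    by (intro sum.cong) (simp_all add: mult_ac)
  also have "\<dots> = (\<Sum>i\<le>j. ?b i * (\<Sum>\<alpha>=0..n. real (n choose \<alpha>)
      * degen_ffact l (- real i) \<alpha> * degen_ffact l (real j) (n - \<alpha>)))"
    unfolding degen_ffact_uminus sum_distrib_left by (rule sum.swap)
  also have "\<dots> = (\<Sum>i\<le>j. ?b i * degen_ffact l (real j - real i) n)"
    unfolding degen_ffact_Vandermonde[OF assms(1)] by simp
  also have "\<dots> = (\<Sum>i\<le>j. ?b (j - i) * degen_ffact l (real i) n)"
    by (rule sum.reindex_bij_witness[of _ "\<lambda>i. j - i" "\<lambda>i. j - i"]) (auto simp: of_nat_diff)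
  \<comment> \<open>Binomial symmetry, together with the equal parity of \<open>j - i\<close> and
    \<open>j + i\<close>.\<close>
  also have "\<dots> = (-1) ^ j * (\<Sum>i\<le>j. ?b i * degen_ffact l (real i) n)"
    unfolding sum_distrib_left
    by (intro sum.cong)
       (auto simp: binomial_symmetric[symmetric] minus_one_power_iff)
  also have "\<dots> = fact j * degen_Stirling2 l n j"
    unfolding degen_Stirling2_explicit[symmetric] by (simp flip: mult.assoc power_add)
  finally show ?thesis by simp
qed

end
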